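(* Let $n\ge1$, let $\rho=\{r_1,\ldots,r_n\}$ with $0<r_1<\cdots<r_n<\infty$, and let $\alpha,\nu_1,\ldots,\nu_n$ be given real values. Let $\sigma$ be one of the following two functions: $\sigma^A$, the unique element of $\mathcal{S}_0(\rho)$ with $\sigma^A(r_j)=\nu_j$ for $1\le j\le n$ and $\sigma^A(0)=\alpha$; or $\sigma^B$, the unique non-singular element of $\mathcal{S}_0(\rho)$ with $\sigma^B(r_j)=\nu_j$ for $1\le j\le n$. Then there exist unique coefficients $c,a_1,\ldots,a_n$ such that, for all $r\ge0$, $$\sigma(r)=c+\sum_{k=1}^n a_k\,\varphi_0\!\left(\frac{r}{r_k}\right),$$ where, if $\sigma=\sigma^B$, the coefficients also satisfy $$\sum_{k=1}^n a_k r_k^{-2}=0.$$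
   Context: The basis function $\varphi_0:[0,\infty)\to\mathbb{R}$ is $$\varphi_0(r)=\begin{cases} r^2-r^2\ln r,&0\le r\le1,\\ 1+\ln r,&r>1,\end{cases}$$ with $\varphi_0(0)=0$. Define the differential operators $$L_0=r\frac{d^4}{dr^4}+2\frac{d^3}{dr^3}-\frac1r\frac{d^2}{dr^2}+\frac1{r^2}\frac{d}{dr},\quad G_0=\frac{d^3}{dr^3}-\frac1r\frac{d^2}{dr^2}+\frac1{r^2}\frac{d}{dr},\quad R_0=\frac1r\left[\frac{d^2}{dr^2}+\frac1r\frac{d}{dr}\right].$$ On any open subinterval of $(0,\infty)$ their null spaces are $\mathrm{Ker}\,L_0=\mathrm{span}\{r^2,r^2\ln r,1,\ln r\}$, $\mathrm{Ker}\,G_0=\mathrm{span}\{r^2,r^2\ln r,1\}$, $\mathrm{Ker}\,R_0=\mathrm{span}\{1,\ln r\}$. For knots $\rho=\{r_1<\cdots<r_n\}\subset(0,\infty)$, a function $\eta:[0,\infty)\to\mathbb{C}$, continuous at $0$, is called a Beppo Levi $L_0$-spline on $\rho$ if: (i) $L_0\eta(r)=0$ for all $r\in(r_j,r_{j+1})$ and all $j\in\{1,\ldots,n-1\}$; (ii) $G_0\eta(r)=0$ for all $r\in(0,r_1)$ and $R_0\eta(r)=0$ for all $r>r_n$; (iii) $\eta$ is $C^2$-continuous at each knot $r_1,\ldots,r_n$. The set of all such functions is $\mathcal{S}_0(\rho)$. A spline $\eta\in\mathcal{S}_0(\rho)$ is called non-singular if its restriction to $(0,r_1)$ belongs to $\mathrm{span}\{r^2,1\}$.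 For arbitrary real data, the splines $\sigma^A$ and $\sigma^B$ described in the claim exist and are unique. *)

theory Defs
  imports "HOL-Analysis.Analysis"
begin

text \<open>
  Functions on \<open>[0,\<infinity>)\<close> are represented by total functions on \<^typ>\<open>real\<close>; no definition below
  depends on their values at negative arguments. A knot sequence
  \<open>0 < r\<^sub>1 < \<dots> < r\<^sub>n\<close> is a function \<open>\<rho> :: nat \<Rightarrow> real\<close> of which only \<open>\<rho> 1, \<dots>, \<rho> n\<close> matter.
\<close>

text \<open>At \<open>r = 0\<close> this yields \<open>0\<close>, because \<open>ln 0 = 0\<close> in HOL.\<close>

definition phi0 :: "real \<Rightarrow> real" where
  "phi0 r = (if r \<le> 1 then r\<^sup>2 - r\<^sup>2 * ln r else 1 + ln r)"

definition nth_deriv :: "nat \<Rightarrow> (real \<Rightarrow> complex) \<Rightarrow> real \<Rightarrow> complex" where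
  "nth_deriv k f = ((\<lambda>g x. vector_derivative g (at x)) ^^ k) f"

text \<open>Used for open \<open>S\<close> only. Since \<^const>\<open>vector_derivative\<close> is total, existence of the
  derivatives has to be stated separately from differential equations for them.\<close>

definition times_differentiable_on :: "nat \<Rightarrow> (real \<Rightarrow> complex) \<Rightarrow> real set \<Rightarrow> bool" where
  "times_differentiable_on k f S \<longleftrightarrow> (\<forall>j<k. \<forall>x\<in>S. nth_deriv j f differentiable (at x))"

definition Ck_at :: "nat \<Rightarrow> (real \<Rightarrow> complex) \<Rightarrow> real \<Rightarrow> bool" where
  "Ck_at k f x \<longleftrightarrow>
    (\<exists>U. open U \<and> x \<in> U \<and> times_differentiable_on k f U \<and> continuous_on U (nth_deriv k f))"

definition L0 :: "(real \<Rightarrow> complex) \<Rightarrow> real \<Rightarrow> complex" where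
  "L0 f r = r *\<^sub>R nth_deriv 4 f r + 2 *\<^sub>R nth_deriv 3 f r
            - (1 / r) *\<^sub>R nth_deriv 2 f r + (1 / r\<^sup>2) *\<^sub>R nth_deriv 1 f r"

definition G0 :: "(real \<Rightarrow> complex) \<Rightarrow> real \<Rightarrow> complex" where
  "G0 f r = nth_deriv 3 f r - (1 / r) *\<^sub>R nth_deriv 2 f r + (1 / r\<^sup>2) *\<^sub>R nth_deriv 1 f r"

definition R0 :: "(real \<Rightarrow> complex) \<Rightarrow> real \<Rightarrow> complex" where
  "R0 f r = (1 / r) *\<^sub>R (nth_deriv 2 f r + (1 / r) *\<^sub>R nth_deriv 1 f r)"

definition beppo_levi_splines :: "nat \<Rightarrow> (nat \<Rightarrow> real) \<Rightarrow> (real \<Rightarrow> complex) set" where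
  "beppo_levi_splines n \<rho> = {\<eta>.
     continuous (at 0 within {0..}) \<eta> \<and>
     (\<forall>j\<in>{1..<n}. times_differentiable_on 4 \<eta> {\<rho> j<..<\<rho> (j + 1)} \<and>
                  (\<forall>r\<in>{\<rho> j<..<\<rho> (j + 1)}. L0 \<eta> r = 0)) \<and>
     times_differentiable_on 3 \<eta> {0<..<\<rho> 1} \<and> (\<forall>r\<in>{0<..<\<rho> 1}. G0 \<eta> r = 0) \<and>
     times_differentiable_on 2 \<eta> {\<rho> n<..} \<and> (\<forall>r\<in>{\<rho> n<..}. R0 \<eta> r = 0) \<and>
     (\<forall>j\<in>{1..n}. Ck_at 2 \<eta> (\<rho> j))}"

definition nonsingular :: "(nat \<Rightarrow> real) \<Rightarrow> (real \<Rightarrow> complex) \<Rightarrow> bool" where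
  "nonsingular \<rho> \<eta> \<longleftrightarrow>
    (\<exists>A B :: complex. \<forall>r\<in>{0<..<\<rho> 1}. \<eta> r = A * of_real (r\<^sup>2) + B)"

definition is_sigma_A ::
  "nat \<Rightarrow> (nat \<Rightarrow> real) \<Rightarrow> real \<Rightarrow> (nat \<Rightarrow> real) \<Rightarrow> (real \<Rightarrow> complex) \<Rightarrow> bool" where
  "is_sigma_A n \<rho> \<alpha> \<nu> \<sigma> \<longleftrightarrow>
    \<sigma> \<in> beppo_levi_splines n \<rho> \<and> (\<forall>j\<in>{1..n}. \<sigma> (\<rho> j) = of_real (\<nu> j)) \<and> \<sigma> 0 = of_real \<alpha>"

definition is_sigma_B ::
  "nat \<Rightarrow> (nat \<Rightarrow> real) \<Rightarrow> (nat \<Rightarrow> real) \<Rightarrow> (real \<Rightarrow> complex) \<Rightarrow> bool" where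
  "is_sigma_B n \<rho> \<nu> \<sigma> \<longleftrightarrow>
    \<sigma> \<in> beppo_levi_splines n \<rho> \<and> nonsingular \<rho> \<sigma> \<and> (\<forall>j\<in>{1..n}. \<sigma> (\<rho> j) = of_real (\<nu> j))"

definition has_phi0_expansion ::
  "nat \<Rightarrow> (nat \<Rightarrow> real) \<Rightarrow> (real \<Rightarrow> complex) \<Rightarrow> complex \<Rightarrow> (nat \<Rightarrow> complex) \<Rightarrow> bool" where
  "has_phi0_expansion n \<rho> \<sigma> c a \<longleftrightarrow>
    (\<forall>r\<ge>0. \<sigma> r = c + (\<Sum>k=1..n. a k * of_real (phi0 (r / \<rho> k))))"

end

theory Submission
  imports Defs "HOL-Real_Asymp.Real_Asymp"
begin

text \<open>
  \<open>L\<^sub>0\<close> is \<open>r\<close> times the radial bi-Laplacian of the plane, so between knots a spline is a combination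
  \<open>p r\<^sup>2 + q r\<^sup>2 ln r + s + t ln r\<close>, without \<open>ln r\<close> before the first knot and without \<open>r\<^sup>2\<close> and
  \<open>r\<^sup>2 ln r\<close> after the last one. Two such functions with the same value and the same first two
  derivatives at a point differ by a multiple of one fixed function (\<open>biharm_contact\<close>), and that
  function is exactly the difference between the outer and the inner branch of \<open>\<phi>\<^sub>0(r/r\<^sub>k)\<close>, if the
  point is \<open>r\<^sub>k\<close>. Hence, if \<open>a\<^sub>k\<close> is the jump of the coefficient \<open>t\<close> at \<open>r\<^sub>k\<close>, then
  \<open>\<sigma> - \<Sum> a\<^sub>k \<phi>\<^sub>0(r/r\<^sub>k)\<close> has the same four coefficients on every piece; the end conditions kill all of
  them but the constant one, which is \<open>\<sigma>(0)\<close> by continuity (\<open>spline_expansion\<close>). The coefficient of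
  \<open>r\<^sup>2 ln r\<close> near \<open>0\<close> is \<open>- \<Sum> a\<^sub>k r\<^sub>k\<^sup>-\<^sup>2\<close>, so it vanishes for a non-singular spline.

  The coefficients obtained in this way are complex. That they are real, and that they are unique,
  both follow from one fact about real expansions \<open>f\<close> (\<open>vanishing_expansion\<close>): if \<open>f\<close> vanishes at all
  knots, and also vanishes at \<open>0\<close> or is non-singular, then all coefficients of \<open>f\<close> vanish. It is
  applied to the imaginary part of \<open>\<sigma>\<close>, and to the real and imaginary parts of the difference of two
  expansions. The classical reason for it is that such an \<open>f\<close> has Beppo Levi energy
  \<open>\<integral> r f''\<^sup>2 + f'\<^sup>2/r dr = 0\<close>, by integration by parts. The integral itself can be avoided. On a piece
  with coefficient \<open>q\<close>, the function \<open>W = r f' f'' - 4 q f\<close> is a primitive of the energy density,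
  so it is nondecreasing. At the knots, where \<open>f = 0\<close>, it equals \<open>r f' f''\<close>, which does not
  depend on the side from which it is computed. So \<open>r f' f''\<close> does not decrease from knot to knot, while
  the end conditions make it nonnegative at the first knot and nonpositive at the last. Then it is \<open>0\<close> at
  all knots, \<open>W\<close> is constant on every piece, and \<open>q\<close> vanishes on every piece. The jumps of \<open>q\<close> are
  \<open>a\<^sub>k r\<^sub>k\<^sup>-\<^sup>2\<close>.
\<close>

section \<open>Radial biharmonic functions\<close>

text \<open>
  The coefficients lie in an arbitrary normed field because complex ones are needed for splines and
  real ones for the energy argument.
\<close>

definition biharm :: "'a \<Rightarrow> 'a \<Rightarrow> 'a \<Rightarrow> 'a \<Rightarrow> real \<Rightarrow> 'a::real_normed_field" where
  "biharm p q s t r = of_real (r\<^sup>2) * p + of_real (r\<^sup>2 * ln r) * q + s + of_real (ln r) * t"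

definition biharm' :: "'a \<Rightarrow> 'a \<Rightarrow> 'a \<Rightarrow> real \<Rightarrow> 'a::real_normed_field" where
  "biharm' p q t r = of_real (2 * r) * p + of_real (2 * r * ln r + r) * q + of_real (1 / r) * t"

definition biharm'' :: "'a \<Rightarrow> 'a \<Rightarrow> 'a \<Rightarrow> real \<Rightarrow> 'a::real_normed_field" where
  "biharm'' p q t r = of_real 2 * p + of_real (2 * ln r + 3) * q - of_real (1 / r\<^sup>2) * t"

lemma has_vector_derivative_of_real_mult:
  fixes p :: "'a::real_normed_field"
  assumes "(g has_real_derivative g') (at x)"
  shows "((\<lambda>r. of_real (g r) * p) has_vector_derivative of_real g' * p) (at x)"
  using assms by (intro has_vector_derivative_mult_left has_vector_derivative_of_real)
    (simp add: has_real_derivative_iff_has_vector_derivative)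

lemma biharm_has_derivative:
  assumes "0 < x"
  shows "(biharm p q s t has_vector_derivative biharm' p q t x) (at x)"
proof -
  have "((\<lambda>r. r\<^sup>2) has_real_derivative 2 * x) (at x)"
    by (auto intro!: derivative_eq_intros)
  moreover have "((\<lambda>r. r\<^sup>2 * ln r) has_real_derivative 2 * x * ln x + x) (at x)"
    using assms by (auto intro!: derivative_eq_intros simp: field_simps power2_eq_square)
  moreover have "(ln has_real_derivative 1 / x) (at x)"
    using assms by (auto intro!: derivative_eq_intros)
  ultimately have "((\<lambda>r. of_real (r\<^sup>2) * p + of_real (r\<^sup>2 * ln r) * q + s + of_real (ln r) * t)
      has_vector_derivative of_real (2 * x) * p + of_real (2 * x * ln x + x) * q + 0 + of_real (1 / x) * t) (at x)"
    by (intro has_vector_derivative_add has_vector_derivative_of_real_mult has_vector_derivative_const)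
  then show ?thesis
    by (simp add: biharm_def[abs_def] biharm'_def)
qed

lemma biharm'_has_derivative:
  assumes "0 < x"
  shows "(biharm' p q t has_vector_derivative biharm'' p q t x) (at x)"
proof -
  have "((\<lambda>r. 2 * r) has_real_derivative 2) (at x)"
    by (auto intro!: derivative_eq_intros)
  moreover have "((\<lambda>r. 2 * r * ln r + r) has_real_derivative 2 * ln x + 3) (at x)"
    using assms by (auto intro!: derivative_eq_intros simp: field_simps)
  moreover have "((\<lambda>r. 1 / r) has_real_derivative - (1 / x\<^sup>2)) (at x)"
    using assms by (auto intro!: derivative_eq_intros simp: field_simps power2_eq_square)
  ultimately have "((\<lambda>r. of_real (2 * r) * p + of_real (2 * r * ln r + r) * q + of_real (1 / r) * t)
      has_vector_derivative of_real 2 * p + of_real (2 * ln x + 3) * q + of_real (- (1 / x\<^sup>2)) * t) (at x)"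
    by (intro has_vector_derivative_add has_vector_derivative_of_real_mult)
  then show ?thesis
    by (simp add: biharm'_def[abs_def] biharm''_def)
qed

lemma isCont_biharm:
  assumes "0 < x"
  shows "isCont (biharm p q s t) x" "isCont (biharm' p q t) x" "isCont (biharm'' p q t) x"
  using assms unfolding biharm_def[abs_def] biharm'_def[abs_def] biharm''_def[abs_def]
  by (auto intro!: continuous_intros)

text \<open>
  Contact of order two leaves one free parameter, since three equations hold between four
  coefficients. The parameter chosen is the difference of the coefficients of \<open>ln\<close>; it is \<open>1\<close> for
  the function \<open>1 + ln (r/x) - (r/x)\<^sup>2 + (r/x)\<^sup>2 ln (r/x)\<close>, which has a triple zero at \<open>x\<close>.
\<close>

lemma biharm_contact:
  fixes p q s t P Q S T :: "'a::real_normed_field"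
  assumes x: "0 < x"
    and eq: "biharm p q s t x = biharm P Q S T x" "biharm' p q t x = biharm' P Q T x"
      "biharm'' p q t x = biharm'' P Q T x"
  shows "P = p - (T - t) * of_real ((1 + ln x) / x\<^sup>2)"
    and "Q = q + (T - t) * of_real (1 / x\<^sup>2)"
    and "S = s + (T - t) * of_real (1 - ln x)"
proof -
  define X L where "X = (of_real x :: 'a)" and "L = (of_real (ln x) :: 'a)"
  have X: "X \<noteq> 0" using x by (simp add: X_def)
  have e0: "X\<^sup>2 * p + X\<^sup>2 * L * q + s + L * t = X\<^sup>2 * P + X\<^sup>2 * L * Q + S + L * T"
    and e1: "2 * X * p + (2 * X * L + X) * q + t / X = 2 * X * P + (2 * X * L + X) * Q + T / X"
    and e2: "2 * p + (2 * L + 3) * q - t / X\<^sup>2 = 2 * P + (2 * L + 3) * Q - T / X\<^sup>2"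
    using eq by (simp_all add: biharm_def biharm'_def biharm''_def X_def L_def)
  have e1': "2 * p + (2 * L + 1) * q + t / X\<^sup>2 = 2 * P + (2 * L + 1) * Q + T / X\<^sup>2"
  proof -
    have "X * (2 * p + (2 * L + 1) * q + t / X\<^sup>2) = X * (2 * P + (2 * L + 1) * Q + T / X\<^sup>2)"
      using e1 X by (simp add: algebra_simps power2_eq_square)
    with X show ?thesis by simp
  qed
  have "2 * Q = 2 * (q + (T - t) / X\<^sup>2)"
    using e1' e2 by (simp add: algebra_simps diff_divide_distrib) algebra
  then have Q: "Q = q + (T - t) / X\<^sup>2" by (metis mult_cancel_left zero_neq_numeral)
  have "2 * P = 2 * (p - (1 + L) * ((T - t) / X\<^sup>2))"
    using e1' e2 Q by (simp add: algebra_simps diff_divide_distrib) algebra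
  then have P: "P = p - (1 + L) * ((T - t) / X\<^sup>2)" by (metis mult_cancel_left zero_neq_numeral)
  have "S = s + L * t - L * T - X\<^sup>2 * ((P - p) + L * (Q - q))"
    using e0 by algebra
  also have "\<dots> = s + (T - t) * (1 - L)"
    unfolding P Q using X by (simp add: field_simps)
  finally show "S = s + (T - t) * of_real (1 - ln x)" by (simp add: L_def)
  show "P = p - (T - t) * of_real ((1 + ln x) / x\<^sup>2)"
    "Q = q + (T - t) * of_real (1 / x\<^sup>2)"
    using P Q by (simp_all add: X_def L_def)
qed

lemma primitive_unique:
  fixes f g :: "real \<Rightarrow> 'a::real_normed_vector"
  assumes "convex I"
    and "\<And>x. x \<in> I \<Longrightarrow> (f has_vector_derivative h x) (at x)"
    and "\<And>x. x \<in> I \<Longrightarrow> (g has_vector_derivative h x) (at x)"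
  obtains C where "\<And>x. x \<in> I \<Longrightarrow> f x = C + g x"
proof -
  have der: "((\<lambda>x. f x - g x) has_vector_derivative 0) (at x within I)" if "x \<in> I" for x
    using has_vector_derivative_diff[OF assms(2,3)[OF that]]
    by (auto intro: has_vector_derivative_at_within)
  show ?thesis
  proof (rule has_vector_derivative_zero_constant[OF assms(1) der])
    fix C assume "\<And>x. x \<in> I \<Longrightarrow> f x - g x = C"
    then show ?thesis
      by (intro that[of C]) (simp add: diff_eq_eq)
  qed
qed

section \<open>The null spaces of the three operators\<close>

lemma times_differentiable_onD:
  assumes "times_differentiable_on k f S" "x \<in> S" "j < k"
  shows "(nth_deriv j f has_vector_derivative nth_deriv (Suc j) f x) (at x)"
  using assms by (simp add: times_differentiable_on_def nth_deriv_def vector_derivative_works)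

lemma nth_deriv_0 [simp]: "nth_deriv 0 f = f"
  by (simp add: nth_deriv_def)

text \<open>
  \<open>L\<^sub>0 f\<close> factors as \<open>(r (f'' + f'/r)')'\<close>, and \<open>f'' + f'/r = (r f')'/r\<close>, so the equation is solved by
  four successive integrations.
\<close>

lemma L0_kernel:
  assumes I: "convex I" "\<And>x. x \<in> I \<Longrightarrow> 0 < x"
    and d: "times_differentiable_on 4 f I" and L: "\<And>x. x \<in> I \<Longrightarrow> L0 f x = 0"
  obtains p q s t where "\<And>x. x \<in> I \<Longrightarrow> f x = biharm p q s t x"
proof -
  let ?D = "\<lambda>j. nth_deriv j f"
  have D: "(f has_vector_derivative ?D 1 x) (at x)" "(?D 1 has_vector_derivative ?D 2 x) (at x)"
    "(?D 2 has_vector_derivative ?D 3 x) (at x)" "(?D 3 has_vector_derivative ?D 4 x) (at x)"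
    if "x \<in> I" for x
    using times_differentiable_onD[OF d that, of 0] times_differentiable_onD[OF d that, of 1]
      times_differentiable_onD[OF d that, of 2] times_differentiable_onD[OF d that, of 3]
    by (simp_all add: eval_nat_numeral)
  note scale = has_vector_derivative_scaleR
  have inv: "((\<lambda>r. 1 / r) has_real_derivative - (1 / x\<^sup>2)) (at x)" if "x \<in> I" for x
    using I(2)[OF that] by (auto intro!: derivative_eq_intros simp: field_simps power2_eq_square)
  have idd: "((\<lambda>r. r) has_real_derivative 1) (at x)" for x :: real
    by (auto intro!: derivative_eq_intros)
  have "((\<lambda>r. r *\<^sub>R ?D 3 r + ?D 2 r - (1 / r) *\<^sub>R ?D 1 r) has_vector_derivative 0) (at x)"
    if "x \<in> I" for x
  proof -
    have "((\<lambda>r. r *\<^sub>R ?D 3 r + ?D 2 r - (1 / r) *\<^sub>R ?D 1 r) has_vector_derivative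
        (x *\<^sub>R ?D 4 x + 1 *\<^sub>R ?D 3 x) + ?D 3 x - ((1 / x) *\<^sub>R ?D 2 x + (- (1 / x\<^sup>2)) *\<^sub>R ?D 1 x)) (at x)"
      by (intro has_vector_derivative_add has_vector_derivative_diff scale D[OF that] inv[OF that] idd)
    moreover have "(x *\<^sub>R ?D 4 x + 1 *\<^sub>R ?D 3 x) + ?D 3 x - ((1 / x) *\<^sub>R ?D 2 x + (- (1 / x\<^sup>2)) *\<^sub>R ?D 1 x) = 0"
      using L[OF that] unfolding L0_def by (simp add: algebra_simps scaleR_2)
    ultimately show ?thesis by metis
  qed
  from primitive_unique[OF I(1) this has_vector_derivative_const[of 0]]
  obtain c where c: "\<And>x. x \<in> I \<Longrightarrow> x *\<^sub>R ?D 3 x + ?D 2 x - (1 / x) *\<^sub>R ?D 1 x = c"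
    by metis
  have M: "((\<lambda>r. ?D 2 r + (1 / r) *\<^sub>R ?D 1 r) has_vector_derivative of_real (1 / x) * c) (at x)"
    if "x \<in> I" for x
  proof -
    have "((\<lambda>r. ?D 2 r + (1 / r) *\<^sub>R ?D 1 r) has_vector_derivative
        ?D 3 x + ((1 / x) *\<^sub>R ?D 2 x + (- (1 / x\<^sup>2)) *\<^sub>R ?D 1 x)) (at x)"
      by (intro has_vector_derivative_add scale D[OF that] inv[OF that])
    moreover have "?D 3 x + ((1 / x) *\<^sub>R ?D 2 x + (- (1 / x\<^sup>2)) *\<^sub>R ?D 1 x) = of_real (1 / x) * c"
      using I(2)[OF that] unfolding c[OF that, symmetric]
      by (simp add: scaleR_conv_of_real field_simps power2_eq_square)
    ultimately show ?thesis by metis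
  qed
  have lnd: "((\<lambda>r. of_real (ln r) * c) has_vector_derivative of_real (1 / x) * c) (at x)"
    if "x \<in> I" for x and c :: complex
    using I(2)[OF that]
    by (intro has_vector_derivative_of_real_mult) (auto intro!: derivative_eq_intros)
  from primitive_unique[OF I(1) M lnd] obtain k where
    k: "\<And>x. x \<in> I \<Longrightarrow> ?D 2 x + (1 / x) *\<^sub>R ?D 1 x = k + of_real (ln x) * c" by metis
  have N: "((\<lambda>r. r *\<^sub>R ?D 1 r) has_vector_derivative of_real x * k + of_real (x * ln x) * c) (at x)"
    if "x \<in> I" for x
  proof -
    have "((\<lambda>r. r *\<^sub>R ?D 1 r) has_vector_derivative x *\<^sub>R ?D 2 x + 1 *\<^sub>R ?D 1 x) (at x)"
      by (intro scale D[OF that] idd)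
    moreover have "x *\<^sub>R ?D 2 x + 1 *\<^sub>R ?D 1 x = x *\<^sub>R (?D 2 x + (1 / x) *\<^sub>R ?D 1 x)"
      using I(2)[OF that] by (simp add: algebra_simps)
    moreover have "\<dots> = of_real x * k + of_real (x * ln x) * c"
      unfolding k[OF that] by (simp add: scaleR_conv_of_real algebra_simps)
    ultimately show ?thesis by metis
  qed
  have N': "((\<lambda>r. of_real (r\<^sup>2 / 2) * k + of_real (r\<^sup>2 * ln r / 2 - r\<^sup>2 / 4) * c) has_vector_derivative
      of_real x * k + of_real (x * ln x) * c) (at x)" if "x \<in> I" for x
    using I(2)[OF that]
    by (intro has_vector_derivative_add has_vector_derivative_of_real_mult)
       (auto intro!: derivative_eq_intros simp: field_simps power2_eq_square)
  from primitive_unique[OF I(1) N N'] obtain t where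
    t: "\<And>x. x \<in> I \<Longrightarrow> x *\<^sub>R ?D 1 x = t + (of_real (x\<^sup>2 / 2) * k + of_real (x\<^sup>2 * ln x / 2 - x\<^sup>2 / 4) * c)"
    by metis
  have E: "biharm' (k / 4 - c / 4) (c / 4) t x = ?D 1 x" if "x \<in> I" for x
  proof -
    have "x *\<^sub>R biharm' (k / 4 - c / 4) (c / 4) t x = x *\<^sub>R ?D 1 x"
      unfolding t[OF that] biharm'_def using I(2)[OF that]
      by (simp add: scaleR_conv_of_real field_simps power2_eq_square)
    then show ?thesis using I(2)[OF that] by simp
  qed
  have B: "(biharm (k / 4 - c / 4) (c / 4) 0 t has_vector_derivative ?D 1 x) (at x)"
    if "x \<in> I" for x
    using biharm_has_derivative[OF I(2)[OF that]] E[OF that] by metis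
  from primitive_unique[OF I(1) D(1) B] obtain s where
    s: "\<And>x. x \<in> I \<Longrightarrow> f x = s + biharm (k / 4 - c / 4) (c / 4) 0 t x" by metis
  then show ?thesis
    by (intro that[of "k / 4 - c / 4" "c / 4" s t]) (simp add: biharm_def)
qed

text \<open>Three integrations suffice, because \<open>G\<^sub>0 f = (f'' - f'/r)'\<close> and \<open>f'' - f'/r = r (f'/r)'\<close>.\<close>

lemma G0_kernel:
  assumes I: "convex I" "\<And>x. x \<in> I \<Longrightarrow> 0 < x"
    and d: "times_differentiable_on 3 f I" and G: "\<And>x. x \<in> I \<Longrightarrow> G0 f x = 0"
  obtains p q s where "\<And>x. x \<in> I \<Longrightarrow> f x = biharm p q s 0 x"
proof -
  let ?D = "\<lambda>j. nth_deriv j f"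
  have D: "(f has_vector_derivative ?D 1 x) (at x)" "(?D 1 has_vector_derivative ?D 2 x) (at x)"
    "(?D 2 has_vector_derivative ?D 3 x) (at x)"
    if "x \<in> I" for x
    using times_differentiable_onD[OF d that, of 0] times_differentiable_onD[OF d that, of 1]
      times_differentiable_onD[OF d that, of 2]
    by (simp_all add: eval_nat_numeral)
  have quot: "((\<lambda>r. (1 / r) *\<^sub>R ?D 1 r) has_vector_derivative
      (1 / x) *\<^sub>R ?D 2 x + (- (1 / x\<^sup>2)) *\<^sub>R ?D 1 x) (at x)" if "x \<in> I" for x
    using I(2)[OF that] 
    by (intro has_vector_derivative_scaleR D[OF that])
       (auto intro!: derivative_eq_intros simp: field_simps power2_eq_square)
  have "((\<lambda>r. ?D 2 r - (1 / r) *\<^sub>R ?D 1 r) has_vector_derivative 0) (at x)" if "x \<in> I" for x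
  proof -
    have "?D 3 x - ((1 / x) *\<^sub>R ?D 2 x + (- (1 / x\<^sup>2)) *\<^sub>R ?D 1 x) = 0"
      using G[OF that] unfolding G0_def by (simp add: algebra_simps)
    then show ?thesis
      using has_vector_derivative_diff[OF D(3)[OF that] quot[OF that]] by metis
  qed
  from primitive_unique[OF I(1) this has_vector_derivative_const[of 0]]
  obtain h where h: "\<And>x. x \<in> I \<Longrightarrow> ?D 2 x - (1 / x) *\<^sub>R ?D 1 x = h"
    by metis
  have M: "((\<lambda>r. (1 / r) *\<^sub>R ?D 1 r) has_vector_derivative of_real (1 / x) * h) (at x)"
    if "x \<in> I" for x
  proof -
    have "(1 / x) *\<^sub>R ?D 2 x + (- (1 / x\<^sup>2)) *\<^sub>R ?D 1 x = of_real (1 / x) * h"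
      unfolding h[OF that, symmetric]
      by (simp add: scaleR_conv_of_real algebra_simps power2_eq_square)
    then show ?thesis using quot[OF that] by metis
  qed
  have M': "((\<lambda>r. of_real (ln r) * h) has_vector_derivative of_real (1 / x) * h) (at x)"
    if "x \<in> I" for x
    using I(2)[OF that]
    by (intro has_vector_derivative_of_real_mult) (auto intro!: derivative_eq_intros)
  from primitive_unique[OF I(1) M M'] obtain k where
    k: "\<And>x. x \<in> I \<Longrightarrow> (1 / x) *\<^sub>R ?D 1 x = k + of_real (ln x) * h" by metis
  have E: "biharm' (k / 2 - h / 4) (h / 2) 0 x = ?D 1 x" if "x \<in> I" for x
  proof -
    have "?D 1 x = x *\<^sub>R ((1 / x) *\<^sub>R ?D 1 x)"
      using I(2)[OF that] by simp
    also have "\<dots> = biharm' (k / 2 - h / 4) (h / 2) 0 x"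
      unfolding k[OF that] biharm'_def by (simp add: scaleR_conv_of_real field_simps)
    finally show ?thesis by simp
  qed
  have B: "(biharm (k / 2 - h / 4) (h / 2) 0 0 has_vector_derivative ?D 1 x) (at x)"
    if "x \<in> I" for x
    using biharm_has_derivative[OF I(2)[OF that]] E[OF that] by metis
  from primitive_unique[OF I(1) D(1) B] obtain s where
    s: "\<And>x. x \<in> I \<Longrightarrow> f x = s + biharm (k / 2 - h / 4) (h / 2) 0 0 x" by metis
  then show ?thesis
    by (intro that[of "k / 2 - h / 4" "h / 2" s]) (simp add: biharm_def)
qed

text \<open>Two integrations suffice, because \<open>r\<^sup>2 R\<^sub>0 f = (r f')'\<close>.\<close>

lemma R0_kernel:
  assumes I: "convex I" "\<And>x. x \<in> I \<Longrightarrow> 0 < x"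
    and d: "times_differentiable_on 2 f I" and R: "\<And>x. x \<in> I \<Longrightarrow> R0 f x = 0"
  obtains s t where "\<And>x. x \<in> I \<Longrightarrow> f x = biharm 0 0 s t x"
proof -
  let ?D = "\<lambda>j. nth_deriv j f"
  have D: "(f has_vector_derivative ?D 1 x) (at x)" "(?D 1 has_vector_derivative ?D 2 x) (at x)"
    if "x \<in> I" for x
    using times_differentiable_onD[OF d that, of 0] times_differentiable_onD[OF d that, of 1]
    by (simp_all add: eval_nat_numeral)
  have "((\<lambda>r. r *\<^sub>R ?D 1 r) has_vector_derivative 0) (at x)" if "x \<in> I" for x
  proof -
    have "((\<lambda>r. r *\<^sub>R ?D 1 r) has_vector_derivative x *\<^sub>R ?D 2 x + 1 *\<^sub>R ?D 1 x) (at x)"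
      by (intro has_vector_derivative_scaleR D[OF that]) (auto intro!: derivative_eq_intros)
    moreover have "x *\<^sub>R ?D 2 x + 1 *\<^sub>R ?D 1 x = (x\<^sup>2) *\<^sub>R R0 f x"
      using I(2)[OF that] unfolding R0_def by (simp add: algebra_simps power2_eq_square)
    ultimately show ?thesis using R[OF that] by simp
  qed
  from primitive_unique[OF I(1) this has_vector_derivative_const[of 0]]
  obtain t where t: "\<And>x. x \<in> I \<Longrightarrow> x *\<^sub>R ?D 1 x = t"
    by metis
  have E: "biharm' 0 0 t x = ?D 1 x" if "x \<in> I" for x
    using I(2)[OF that] unfolding t[OF that, symmetric] biharm'_def
    by (simp add: scaleR_conv_of_real)
  have B: "(biharm 0 0 0 t has_vector_derivative ?D 1 x) (at x)" if "x \<in> I" for x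
    using biharm_has_derivative[OF I(2)[OF that]] E[OF that] by metis
  from primitive_unique[OF I(1) D(1) B] obtain s where
    s: "\<And>x. x \<in> I \<Longrightarrow> f x = s + biharm 0 0 0 t x" by metis
  then show ?thesis
    by (intro that[of s t]) (simp add: biharm_def)
qed

lemma nth_deriv_biharm:
  assumes S: "open S" "\<And>x. x \<in> S \<Longrightarrow> 0 < x" and f: "\<And>x. x \<in> S \<Longrightarrow> f x = biharm p q s t x"
    and x: "x \<in> S"
  shows "nth_deriv 1 f x = biharm' p q t x" "nth_deriv 2 f x = biharm'' p q t x"
proof -
  have 1: "nth_deriv 1 f y = biharm' p q t y" if "y \<in> S" for y
  proof -
    have "(f has_vector_derivative biharm' p q t y) (at y)"
      by (rule has_vector_derivative_transform_within_open[OF biharm_has_derivative[OF S(2)[OF that]] S(1) that])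
         (simp add: f)
    then show ?thesis by (simp add: nth_deriv_def vector_derivative_at)
  qed
  show "nth_deriv 1 f x = biharm' p q t x" using 1 x .
  have "(nth_deriv 1 f has_vector_derivative biharm'' p q t x) (at x)"
    by (rule has_vector_derivative_transform_within_open[OF biharm'_has_derivative[OF S(2)[OF x]] S(1) x])
       (rule 1[symmetric])
  then show "nth_deriv 2 f x = biharm'' p q t x"
    by (simp add: nth_deriv_def vector_derivative_at eval_nat_numeral)
qed

text \<open>
  The one-sided limits of a piece at a knot agree with the values of the spline and its derivatives
  there. Applied on both sides of the knot, this turns \<open>C\<^sup>2\<close>-continuity into the contact of two
  neighbouring pieces.
\<close>

lemma Ck_at_boundary:
  assumes x: "0 < x" and C: "Ck_at 2 f x"
    and S: "open S" "\<And>x. x \<in> S \<Longrightarrow> 0 < x" "at x within S \<noteq> bot"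
    and f: "\<And>x. x \<in> S \<Longrightarrow> f x = biharm p q s t x"
  shows "f x = biharm p q s t x" "nth_deriv 1 f x = biharm' p q t x" "nth_deriv 2 f x = biharm'' p q t x"
proof -
  from C obtain U where U: "open U" "x \<in> U" "times_differentiable_on 2 f U" "continuous_on U (nth_deriv 2 f)"
    by (auto simp: Ck_at_def)
  have cont: "isCont f x" "isCont (nth_deriv 1 f) x" "isCont (nth_deriv 2 f) x"
    using U times_differentiable_onD[OF U(3,2), of 0] times_differentiable_onD[OF U(3,2), of 1]
    by (auto intro: has_vector_derivative_continuous simp: continuous_on_eq_continuous_at)
  have match: "g x = h x" if "isCont g x" "isCont h x" "\<And>y. y \<in> S \<Longrightarrow> g y = h y" for g h :: "real \<Rightarrow> complex"
  proof -
    have "(g \<longlongrightarrow> g x) (at x within S)" "(h \<longlongrightarrow> h x) (at x within S)"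
      using that by (auto simp: isCont_def intro: tendsto_within_subset)
    moreover have "\<forall>\<^sub>F y in at x within S. g y = h y"
      using that(3) by (auto simp: eventually_at_filter)
    ultimately show ?thesis
      using tendsto_unique[OF S(3)] tendsto_cong by metis
  qed
  show "f x = biharm p q s t x"
    by (rule match) (use cont isCont_biharm[OF x] f in auto)
  show "nth_deriv 1 f x = biharm' p q t x"
    by (rule match[OF cont(2) isCont_biharm(2)[OF x] nth_deriv_biharm(1)[OF S(1,2) f]])
  show "nth_deriv 2 f x = biharm'' p q t x"
    by (rule match[OF cont(3) isCont_biharm(3)[OF x] nth_deriv_biharm(2)[OF S(1,2) f]])
qed

lemma phi0_inner: "x \<le> 1 \<Longrightarrow> phi0 x = x\<^sup>2 - x\<^sup>2 * ln x"
  by (simp add: phi0_def)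

lemma phi0_outer: "1 \<le> x \<Longrightarrow> phi0 x = 1 + ln x"
  by (cases "x = 1") (auto simp: phi0_def)

section \<open>Expansions and their pieces\<close>

locale knots =
  fixes n :: nat and \<rho> :: "nat \<Rightarrow> real"
  assumes n: "1 \<le> n" and first_pos: "0 < \<rho> 1" and strict_mono: "strict_mono_on {1..n} \<rho>"
begin

lemma knot_less: "i \<in> {1..n} \<Longrightarrow> j \<in> {1..n} \<Longrightarrow> i < j \<Longrightarrow> \<rho> i < \<rho> j"
  by (rule strict_mono_onD[OF strict_mono])

lemma knot_le: "i \<in> {1..n} \<Longrightarrow> j \<in> {1..n} \<Longrightarrow> i \<le> j \<Longrightarrow> \<rho> i \<le> \<rho> j"
  using knot_less[of i j] by (cases "i = j") auto

lemma knot_pos: "k \<in> {1..n} \<Longrightarrow> 0 < \<rho> k"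
  using knot_le[of 1 k] first_pos n by auto

text \<open>
  The coefficients of the expansion on the piece from \<open>\<rho> k\<close> to \<open>\<rho> (k + 1)\<close>: there the summands up
  to \<open>k\<close> are on their outer branch, those after \<open>k\<close> on their inner branch.
\<close>

definition sq_coeff :: "(nat \<Rightarrow> 'a::real_normed_field) \<Rightarrow> nat \<Rightarrow> 'a" where
  "sq_coeff a k = (\<Sum>i\<in>{k<..n}. a i * of_real ((1 + ln (\<rho> i)) / (\<rho> i)\<^sup>2))"

definition sq_ln_coeff :: "(nat \<Rightarrow> 'a::real_normed_field) \<Rightarrow> nat \<Rightarrow> 'a" where
  "sq_ln_coeff a k = - (\<Sum>i\<in>{k<..n}. a i * of_real (1 / (\<rho> i)\<^sup>2))"

definition const_coeff :: "'a \<Rightarrow> (nat \<Rightarrow> 'a::real_normed_field) \<Rightarrow> nat \<Rightarrow> 'a" where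
  "const_coeff c a k = c + (\<Sum>i\<in>{1..k}. a i * of_real (1 - ln (\<rho> i)))"

definition ln_coeff :: "(nat \<Rightarrow> 'a::real_normed_field) \<Rightarrow> nat \<Rightarrow> 'a" where
  "ln_coeff a k = (\<Sum>i\<in>{1..k}. a i)"

lemma coeff_step:
  assumes "k \<in> {1..n}"
  shows "sq_coeff a k = sq_coeff a (k - 1) - a k * of_real ((1 + ln (\<rho> k)) / (\<rho> k)\<^sup>2)"
    and "sq_ln_coeff a k = sq_ln_coeff a (k - 1) + a k * of_real (1 / (\<rho> k)\<^sup>2)"
    and "const_coeff c a k = const_coeff c a (k - 1) + a k * of_real (1 - ln (\<rho> k))"
    and "ln_coeff a k = ln_coeff a (k - 1) + a k"
proof -
  have "{k - 1<..n} = insert k {k<..n}" "{1..k} = insert k {1..k - 1}"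
    using assms by auto
  moreover have "k \<notin> {1..k - 1}"
    using assms by auto
  ultimately show "sq_coeff a k = sq_coeff a (k - 1) - a k * of_real ((1 + ln (\<rho> k)) / (\<rho> k)\<^sup>2)"
    "sq_ln_coeff a k = sq_ln_coeff a (k - 1) + a k * of_real (1 / (\<rho> k)\<^sup>2)"
    "const_coeff c a k = const_coeff c a (k - 1) + a k * of_real (1 - ln (\<rho> k))"
    "ln_coeff a k = ln_coeff a (k - 1) + a k"
    using assms \<open>k \<notin> {1..k - 1}\<close>
    by (simp_all add: sq_coeff_def sq_ln_coeff_def const_coeff_def ln_coeff_def add.commute)
qed

lemma coeff_ends [simp]:
  "sq_coeff a n = 0" "sq_ln_coeff a n = 0" "const_coeff c a 0 = c" "ln_coeff a 0 = 0"
  by (simp_all add: sq_coeff_def sq_ln_coeff_def const_coeff_def ln_coeff_def)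

text \<open>
  The inequalities are weak because the two branches of \<open>\<phi>\<^sub>0\<close> agree at \<open>1\<close>, so that at a knot the
  formulas of both adjacent pieces are available.
\<close>

lemma expansion_on_piece:
  assumes k: "k \<le> n" and r: "0 < r" and lower: "\<And>i. i \<in> {1..k} \<Longrightarrow> \<rho> i \<le> r"
    and upper: "\<And>i. i \<in> {k<..n} \<Longrightarrow> r \<le> \<rho> i"
  shows "c + (\<Sum>i=1..n. a i * of_real (phi0 (r / \<rho> i))) =
    biharm (sq_coeff a k) (sq_ln_coeff a k) (const_coeff c a k) (ln_coeff a k) r"
proof -
  have "{1..n} = {1..k} \<union> {k<..n}" "{1..k} \<inter> {k<..n} = {}" using k by auto
  then have "(\<Sum>i=1..n. a i * of_real (phi0 (r / \<rho> i))) =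
      (\<Sum>i\<in>{1..k}. a i * of_real (phi0 (r / \<rho> i))) + (\<Sum>i\<in>{k<..n}. a i * of_real (phi0 (r / \<rho> i)))"
    by (simp add: sum.union_disjoint)
  also have "(\<Sum>i\<in>{1..k}. a i * of_real (phi0 (r / \<rho> i))) =
      (\<Sum>i\<in>{1..k}. a i * of_real (1 - ln (\<rho> i)) + of_real (ln r) * a i)"
  proof (intro sum.cong refl)
    fix i assume i: "i \<in> {1..k}"
    have "0 < \<rho> i" "1 \<le> r / \<rho> i" using i k knot_pos[of i] lower[OF i] by auto
    then show "a i * of_real (phi0 (r / \<rho> i)) = a i * of_real (1 - ln (\<rho> i)) + of_real (ln r) * a i"
      using r by (simp add: phi0_outer ln_div algebra_simps)
  qed
  also have "(\<Sum>i\<in>{k<..n}. a i * of_real (phi0 (r / \<rho> i))) =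
      (\<Sum>i\<in>{k<..n}. of_real (r\<^sup>2) * (a i * of_real ((1 + ln (\<rho> i)) / (\<rho> i)\<^sup>2)) -
        of_real (r\<^sup>2 * ln r) * (a i * of_real (1 / (\<rho> i)\<^sup>2)))"
  proof (intro sum.cong refl)
    fix i assume i: "i \<in> {k<..n}"
    have pos: "0 < \<rho> i" "r / \<rho> i \<le> 1" using i k knot_pos[of i] upper[OF i] by auto
    then have "phi0 (r / \<rho> i) = r\<^sup>2 * ((1 + ln (\<rho> i)) / (\<rho> i)\<^sup>2) - r\<^sup>2 * ln r * (1 / (\<rho> i)\<^sup>2)"
      using r by (simp add: phi0_inner ln_div field_simps)
    then show "a i * of_real (phi0 (r / \<rho> i)) = of_real (r\<^sup>2) * (a i * of_real ((1 + ln (\<rho> i)) / (\<rho> i)\<^sup>2)) -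
        of_real (r\<^sup>2 * ln r) * (a i * of_real (1 / (\<rho> i)\<^sup>2))"
      by (simp only: of_real_diff of_real_mult) (simp only: algebra_simps)
  qed
  finally show ?thesis
    by (simp add: biharm_def sq_coeff_def sq_ln_coeff_def const_coeff_def ln_coeff_def
        sum.distrib sum_subtractf sum_distrib_left)
qed

end

section \<open>The energy argument\<close>

text \<open>
  The quantity \<open>r f' f''\<close> does not decrease from one zero of \<open>f\<close> to the next one, since there it
  agrees with \<open>W = r f' f'' - 4 q f\<close>, and \<open>W' = r f''\<^sup>2 + f'\<^sup>2/r\<close>. The factor \<open>4 q\<close> is the constant
  \<open>(r f'')' - f'/r\<close>. Equality forces \<open>f' = f'' = 0\<close> in between.
\<close>

lemma biharm_flux_strict:
  fixes p q s t u v :: real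
  assumes uv: "0 < u" "u < v" and zero: "biharm p q s t u = 0" "biharm p q s t v = 0"
  shows "u * biharm' p q t u * biharm'' p q t u \<le> v * biharm' p q t v * biharm'' p q t v"
    and "u * biharm' p q t u * biharm'' p q t u = v * biharm' p q t v * biharm'' p q t v \<Longrightarrow> q = 0"
proof -
  define W where "W = (\<lambda>r. r * biharm' p q t r * biharm'' p q t r - 4 * q * biharm p q s t r)"
  define W' where "W' = (\<lambda>r. r * (biharm'' p q t r)\<^sup>2 + (biharm' p q t r)\<^sup>2 / r)"
  have DW: "(W has_real_derivative W' x) (at x)" if "0 < x" for x
  proof -
    have "(biharm p q s t has_real_derivative biharm' p q t x) (at x)"
      "(biharm' p q t has_real_derivative biharm'' p q t x) (at x)"
      using biharm_has_derivative[OF that] biharm'_has_derivative[OF that]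
      by (simp_all add: has_real_derivative_iff_has_vector_derivative)
    moreover have "(biharm'' p q t has_real_derivative 2 * q / x + 2 * t / x ^ 3) (at x)"
      unfolding biharm''_def[abs_def] using that
      by (auto intro!: derivative_eq_intros simp: field_simps eval_nat_numeral)
    ultimately have "(W has_real_derivative
       (1 * biharm' p q t x + x * biharm'' p q t x) * biharm'' p q t x
        + x * biharm' p q t x * (2 * q / x + 2 * t / x ^ 3) - 4 * q * biharm' p q t x) (at x)"
      unfolding W_def by (auto intro!: derivative_eq_intros simp: algebra_simps)
    moreover have "biharm'' p q t x + x * (2 * q / x + 2 * t / x ^ 3) - 4 * q = biharm' p q t x / x"
      using that by (simp add: biharm'_def biharm''_def field_simps eval_nat_numeral)
    then have "(1 * biharm' p q t x + x * biharm'' p q t x) * biharm'' p q t x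
        + x * biharm' p q t x * (2 * q / x + 2 * t / x ^ 3) - 4 * q * biharm' p q t x = W' x"
      unfolding W'_def power2_eq_square by algebra
    ultimately show ?thesis by metis
  qed
  have W'_nonneg: "0 \<le> W' x" if "0 < x" for x
    using that by (simp add: W'_def)
  have W_mono: "W x \<le> W y" if "0 < x" "x \<le> y" for x y
    by (rule DERIV_nonneg_imp_nondecreasing[OF that(2)]) (use that DW W'_nonneg in \<open>meson less_le_trans\<close>)
  have ends: "W u = u * biharm' p q t u * biharm'' p q t u" "W v = v * biharm' p q t v * biharm'' p q t v"
    using zero by (simp_all add: W_def)
  show "u * biharm' p q t u * biharm'' p q t u \<le> v * biharm' p q t v * biharm'' p q t v"
    using W_mono[of u v] uv ends by simp
  assume "u * biharm' p q t u * biharm'' p q t u = v * biharm' p q t v * biharm'' p q t v"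
  then have "W u = W v" using ends by simp
  have rel: "q * x\<^sup>2 = t" if x: "x \<in> {u<..<v}" for x
  proof -
    have x0: "0 < x" using x uv by simp
    have const: "W y = W u" if "y \<in> {u<..<v}" for y
      using W_mono[of u y] W_mono[of y v] that uv \<open>W u = W v\<close> by simp
    have "((\<lambda>_. W u) has_real_derivative W' x) (at x)"
      by (rule has_field_derivative_transform_within_open[OF DW[OF x0], of "{u<..<v}"])
         (use x const in auto)
    then have "W' x = 0"
      using DERIV_unique[OF _ DERIV_const] by metis
    then have "x * (biharm'' p q t x)\<^sup>2 = 0" "(biharm' p q t x)\<^sup>2 / x = 0"
      using x0 by (simp_all add: W'_def add_nonneg_eq_0_iff)
    then have "biharm' p q t x = 0" "biharm'' p q t x = 0" using x0 by simp_all
    then have "x * biharm'' p q t x - biharm' p q t x = 0" by simp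
    then show ?thesis
      using x0 by (simp add: biharm'_def biharm''_def field_simps power2_eq_square)
  qed
  (* The relation q x^2 = t at two different points x leaves only q = 0. *)
  define x y where "x = (2 * u + v) / 3" and "y = (u + 2 * v) / 3"
  have xy: "x \<in> {u<..<v}" "y \<in> {u<..<v}" "0 < x" "x < y" using uv by (auto simp: x_def y_def)
  have "q * x\<^sup>2 = q * y\<^sup>2" using rel[OF xy(1)] rel[OF xy(2)] by simp
  moreover have "x\<^sup>2 < y\<^sup>2" using xy by (simp add: power_strict_mono)
  ultimately show "q = 0" by simp
qed

text \<open>
  This is the injectivity of interpolation, by the energy argument described at the beginning: the
  numbers \<open>r f' f''\<close> at the knots do not decrease, yet lead from a nonnegative to a
  nonpositive value. On the last piece \<open>f = s + t ln r\<close>, which gives the value \<open>- (t/r)\<^sup>2\<close>. On the first piece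
  \<open>f = p r\<^sup>2 + q r\<^sup>2 ln r + c\<close>, and a multiple of a square results if \<open>q = 0\<close>, or if \<open>c = 0\<close> and
  \<open>f(r\<^sub>1) = 0\<close> is used to eliminate \<open>p\<close>; without such a condition there would be a boundary term
  \<open>4 q c\<close> of arbitrary sign.
\<close>

lemma (in knots) vanishing_expansion:
  fixes c :: real
  assumes zero: "\<And>j. j \<in> {1..n} \<Longrightarrow> c + (\<Sum>k=1..n. a k * phi0 (\<rho> j / \<rho> k)) = 0"
    and side: "c = 0 \<or> (\<Sum>k=1..n. a k / (\<rho> k)\<^sup>2) = 0"
  shows "c = 0" and "\<And>k. k \<in> {1..n} \<Longrightarrow> a k = 0"
proof -
  let ?p = "sq_coeff a" and ?q = "sq_ln_coeff a" and ?s = "const_coeff c a" and ?t = "ln_coeff a"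
  define f' where "f' k = biharm' (?p k) (?q k) (?t k)" for k
  define f'' where "f'' k = biharm'' (?p k) (?q k) (?t k)" for k
  define E where "E k = \<rho> k * f' k (\<rho> k) * f'' k (\<rho> k)" for k
  have fz: "biharm (?p k) (?q k) (?s k) (?t k) (\<rho> j) = 0"
    if j: "j \<in> {1..n}" and kj: "k \<le> j" "j \<le> Suc k" "k \<le> n" for j k
  proof -
    have "\<rho> i \<le> \<rho> j" if "i \<in> {1..k}" for i using that kj j knot_le[of i j] by auto
    moreover have "\<rho> j \<le> \<rho> i" if "i \<in> {k<..n}" for i using that kj j knot_le[of j i] by auto
    ultimately show ?thesis
      using zero[OF j] expansion_on_piece[OF kj(3) knot_pos[OF j], of c a] by simp
  qed
  (* The two branches of phi0 meet at 1 with matching derivatives up to order two. *)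
  have smooth: "f' k (\<rho> k) = f' (k - 1) (\<rho> k)" "f'' k (\<rho> k) = f'' (k - 1) (\<rho> k)"
    if "k \<in> {1..n}" for k
    unfolding f'_def f''_def biharm'_def biharm''_def coeff_step[OF that]
    using knot_pos[OF that] by (simp_all add: field_simps power2_eq_square)
  have E_step: "E k \<le> E (Suc k)" "E k = E (Suc k) \<Longrightarrow> ?q k = 0" if k: "k \<in> {1..<n}" for k
  proof -
    have uv: "0 < \<rho> k" "\<rho> k < \<rho> (Suc k)" using k knot_pos[of k] knot_less[of k "Suc k"] by auto
    have Ek: "E k = \<rho> k * biharm' (?p k) (?q k) (?t k) (\<rho> k) * biharm'' (?p k) (?q k) (?t k) (\<rho> k)"
      by (simp add: E_def f'_def f''_def)
    have ESuc: "E (Suc k) = \<rho> (Suc k) * biharm' (?p k) (?q k) (?t k) (\<rho> (Suc k)) *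
        biharm'' (?p k) (?q k) (?t k) (\<rho> (Suc k))"
      using smooth[of "Suc k"] k by (simp add: E_def f'_def f''_def)
    have z: "biharm (?p k) (?q k) (?s k) (?t k) (\<rho> k) = 0"
      "biharm (?p k) (?q k) (?s k) (?t k) (\<rho> (Suc k)) = 0"
      using fz k by auto
    show "E k \<le> E (Suc k)" "E k = E (Suc k) \<Longrightarrow> ?q k = 0"
      unfolding Ek ESuc by (fact biharm_flux_strict[OF uv z])+
  qed
  have E_1: "0 \<le> E 1" "E 1 = 0 \<Longrightarrow> ?q 0 = 0"
  proof -
    have E1: "E 1 = \<rho> 1 * f' 0 (\<rho> 1) * f'' 0 (\<rho> 1)"
      using smooth[of 1] n by (simp add: E_def)
    have f0: "(\<rho> 1)\<^sup>2 * (?p 0 + ln (\<rho> 1) * ?q 0) + c = 0"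
      using fz[of 1 0] n by (simp add: biharm_def algebra_simps)
    have "?q 0 = 0 \<or> c = 0"
    proof -
      have "{0<..n} = {1..n}" by auto
      then show ?thesis using side by (auto simp: sq_ln_coeff_def)
    qed
    then have "0 \<le> E 1 \<and> (E 1 = 0 \<longrightarrow> ?q 0 = 0)"
    proof
      assume "?q 0 = 0"
      then have "E 1 = (2 * \<rho> 1 * ?p 0)\<^sup>2"
        unfolding E1 by (simp add: f'_def f''_def biharm'_def biharm''_def power2_eq_square)
      then show ?thesis using \<open>?q 0 = 0\<close> by simp
    next
      assume "c = 0"
      then have p: "?p 0 = - ln (\<rho> 1) * ?q 0" using f0 first_pos by (simp add: eq_neg_iff_add_eq_0)
      have "E 1 = 3 * (\<rho> 1 * ?q 0)\<^sup>2"
        unfolding E1 by (simp add: f'_def f''_def biharm'_def biharm''_def p algebra_simps power2_eq_square)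
      then show ?thesis using first_pos by simp
    qed
    then show "0 \<le> E 1" "E 1 = 0 \<Longrightarrow> ?q 0 = 0" by auto
  qed
  have E_n: "E n \<le> 0"
    using knot_pos[of n] n by (simp add: E_def f'_def f''_def biharm'_def biharm''_def)
  have up: "E 1 \<le> E k" if "1 \<le> k" "k \<le> n" for k
    using that
  proof (induction k rule: dec_induct)
    case (step m)
    then show ?case using E_step(1)[of m] by simp
  qed simp
  have down: "E k \<le> E n" if "1 \<le> k" "k \<le> n" for k
    using that(2,1)
  proof (induction k rule: inc_induct)
    case (step m)
    then show ?case using E_step(1)[of m] by simp
  qed simp
  have E0: "E k = 0" if "1 \<le> k" "k \<le> n" for k
    using up[OF that] down[OF that] E_1(1) E_n by simp
  have q0: "?q k = 0" if k: "k \<le> n" for k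
  proof -
    consider "k = 0" | "k = n" | "1 \<le> k" "k < n" using k by linarith
    then show ?thesis
      by cases (use E_1(2) E0[of 1] E_step(2)[of k] E0[of k] E0[of "Suc k"] n in auto)
  qed
  show a0: "a k = 0" if "k \<in> {1..n}" for k
  proof -
    have "k \<le> n" "k - 1 \<le> n" using that by auto
    then show ?thesis
      using coeff_step(2)[OF that, of a] q0[of k] q0[of "k - 1"] knot_pos[OF that] by simp
  qed
  show "c = 0" using zero[of 1] n a0 by simp
qed

section \<open>Every spline has an expansion\<close>

lemma biharm_tendsto_0: "(biharm p q s 0 \<longlongrightarrow> s) (at_right 0)"
proof -
  have "((\<lambda>r::real. r\<^sup>2) \<longlongrightarrow> 0) (at_right 0)" "((\<lambda>r::real. r\<^sup>2 * ln r) \<longlongrightarrow> 0) (at_right 0)"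
    by real_asymp+
  then have "((\<lambda>r. of_real (r\<^sup>2) * p + of_real (r\<^sup>2 * ln r) * q + s + of_real (ln r) * 0) \<longlongrightarrow>
      of_real 0 * p + of_real 0 * q + s + 0) (at_right 0)"
    by (intro tendsto_add tendsto_mult_right tendsto_of_real tendsto_const) auto
  then show ?thesis by (simp add: biharm_def[abs_def])
qed

context knots
begin

definition piece :: "nat \<Rightarrow> real set" where
  "piece k = (if k = 0 then {0<..<\<rho> 1} else if k = n then {\<rho> n<..} else {\<rho> k<..<\<rho> (k + 1)})"

lemma piece_pos: "k \<le> n \<Longrightarrow> x \<in> piece k \<Longrightarrow> 0 < x"
  using knot_pos[of k] knot_pos[of n] n by (auto simp: piece_def split: if_splits)

lemma open_piece: "open (piece k)"
  by (simp add: piece_def)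

lemma knot_limit_point:
  assumes j: "j \<in> {1..n}"
  shows "at (\<rho> j) within piece (j - 1) \<noteq> bot" "at (\<rho> j) within piece j \<noteq> bot"
proof -
  have "\<rho> (j - 1) < \<rho> j" if "j \<noteq> 1"
    using that j by (intro knot_less) auto
  then have "\<rho> j islimpt piece (j - 1)"
    using j first_pos by (auto simp: piece_def islimpt_greaterThanLessThan2)
  then show "at (\<rho> j) within piece (j - 1) \<noteq> bot" by (simp add: trivial_limit_within)
  have "\<rho> j islimpt {\<rho> j<..}"
    by (rule islimpt_subset[OF islimpt_greaterThanLessThan1[of "\<rho> j" "\<rho> j + 1"]]) auto
  then have "\<rho> j islimpt piece j"
    using j knot_less[of j "j + 1"] by (auto simp: piece_def islimpt_greaterThanLessThan1)
  then show "at (\<rho> j) within piece j \<noteq> bot" by (simp add: trivial_limit_within)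
qed

lemma piece_cases:
  assumes "0 < r"
  obtains k where "k \<le> n" "r \<in> piece k \<or> 1 \<le> k \<and> r = \<rho> k"
    "\<forall>i\<in>{1..k}. \<rho> i \<le> r" "\<forall>i\<in>{k<..n}. r \<le> \<rho> i"
proof -
  define K where "K = {i. i \<le> n \<and> (i = 0 \<or> \<rho> i \<le> r)}"
  define k where "k = Max K"
  have K: "finite K" "0 \<in> K" by (auto simp: K_def)
  then have kK: "k \<in> K" unfolding k_def by (intro Max_in) auto
  have after: "r < \<rho> i" if "i \<in> {k<..n}" for i
  proof -
    have "i \<notin> K" using Max_ge[OF K(1), of i] that by (auto simp: k_def)
    then show ?thesis using that by (auto simp: K_def)
  qed
  have "k \<le> n" "k = 0 \<or> \<rho> k \<le> r" using kK by (auto simp: K_def)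
  moreover have "\<forall>i\<in>{1..k}. \<rho> i \<le> r"
  proof
    fix i assume "i \<in> {1..k}"
    then show "\<rho> i \<le> r"
      using knot_le[of i k] \<open>k \<le> n\<close> \<open>k = 0 \<or> \<rho> k \<le> r\<close> by auto
  qed
  moreover have "r \<in> piece k \<or> 1 \<le> k \<and> r = \<rho> k"
    using after[of "k + 1"] \<open>k \<le> n\<close> \<open>k = 0 \<or> \<rho> k \<le> r\<close> assms n by (auto simp: piece_def)
  ultimately show ?thesis using that[of k] after by (meson less_imp_le)
qed

lemma spline_piece:
  assumes \<eta>: "\<eta> \<in> beppo_levi_splines n \<rho>" and k: "k \<le> n"
  shows "\<exists>p q s t. (\<forall>x\<in>piece k. \<eta> x = biharm p q s t x) \<and> (k = 0 \<longrightarrow> t = 0) \<and> (k = n \<longrightarrow> p = 0 \<and> q = 0)"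
proof -
  have conv: "convex (piece k)" by (simp add: piece_def)
  note I = conv piece_pos[OF k]
  consider "k = 0" | "k = n" "k \<noteq> 0" | "k \<in> {1..<n}" using k by fastforce
  then show ?thesis
  proof cases
    case 1
    then have "times_differentiable_on 3 \<eta> (piece k)" "\<And>x. x \<in> piece k \<Longrightarrow> G0 \<eta> x = 0"
      using \<eta> by (auto simp: piece_def beppo_levi_splines_def)
    from G0_kernel[OF I this] show ?thesis using 1 n by (metis not_one_le_zero)
  next
    case 2
    then have "times_differentiable_on 2 \<eta> (piece k)" "\<And>x. x \<in> piece k \<Longrightarrow> R0 \<eta> x = 0"
      using \<eta> by (auto simp: piece_def beppo_levi_splines_def)
    from R0_kernel[OF I this] show ?thesis using 2 by metis
  next
    case 3
    then have "times_differentiable_on 4 \<eta> (piece k)" "\<And>x. x \<in> piece k \<Longrightarrow> L0 \<eta> x = 0"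
      using \<eta> by (auto simp: piece_def beppo_levi_splines_def)
    from L0_kernel[OF I this] show ?thesis using 3 by (metis atLeastLessThan_iff less_irrefl not_one_le_zero)
  qed
qed

text \<open>
  The jumps of all four coefficients at a knot are determined by the jump \<open>a\<^sub>k\<close> of the coefficient of
  \<open>ln\<close>, and they are the jumps of \<open>\<Sum> a\<^sub>k \<phi>\<^sub>0(r/r\<^sub>k)\<close>. Summing them up from the left, where the
  coefficient of \<open>ln\<close> is \<open>0\<close>, and from the right, where those of \<open>r\<^sup>2\<close> and \<open>r\<^sup>2 ln r\<close> are \<open>0\<close>,
  identifies the coefficients of the spline with those of its expansion.
\<close>

lemma spline_expansion:
  assumes \<eta>: "\<eta> \<in> beppo_levi_splines n \<rho>"
  obtains a where "has_phi0_expansion n \<rho> \<eta> (\<eta> 0) a"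
    and "nonsingular \<rho> \<eta> \<longrightarrow> (\<Sum>k=1..n. a k * of_real (1 / (\<rho> k)\<^sup>2)) = 0"
proof -
  have "\<forall>k. \<exists>p q s t. k \<le> n \<longrightarrow> (\<forall>x\<in>piece k. \<eta> x = biharm p q s t x) \<and>
      (k = 0 \<longrightarrow> t = 0) \<and> (k = n \<longrightarrow> p = 0 \<and> q = 0)"
    using spline_piece[OF \<eta>] by blast
  then obtain p q s t where
    pieces: "\<And>k. k \<le> n \<Longrightarrow> (\<forall>x\<in>piece k. \<eta> x = biharm (p k) (q k) (s k) (t k) x) \<and>
      (k = 0 \<longrightarrow> t k = 0) \<and> (k = n \<longrightarrow> p k = 0 \<and> q k = 0)"
    unfolding choice_iff by blast
  have on_piece: "\<eta> x = biharm (p k) (q k) (s k) (t k) x" if "k \<le> n" "x \<in> piece k" for k x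
    using pieces that by blast
  have ends: "t 0 = 0" "p n = 0" "q n = 0" using pieces[of 0] pieces[of n] by auto
  have C2: "Ck_at 2 \<eta> (\<rho> j)" if "j \<in> {1..n}" for j
    using \<eta> that by (auto simp: beppo_levi_splines_def)
  define a where "a k = t k - t (k - 1)" for k
  have left: "\<eta> (\<rho> j) = biharm (p (j - 1)) (q (j - 1)) (s (j - 1)) (t (j - 1)) (\<rho> j)"
    "nth_deriv 1 \<eta> (\<rho> j) = biharm' (p (j - 1)) (q (j - 1)) (t (j - 1)) (\<rho> j)"
    "nth_deriv 2 \<eta> (\<rho> j) = biharm'' (p (j - 1)) (q (j - 1)) (t (j - 1)) (\<rho> j)"
    if j: "j \<in> {1..n}" for j
  proof -
    have le: "j - 1 \<le> n" using j by auto
    note bd = Ck_at_boundary[OF knot_pos[OF j] C2[OF j] open_piece piece_pos[OF le]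
        knot_limit_point(1)[OF j] on_piece[OF le]]
    show "\<eta> (\<rho> j) = biharm (p (j - 1)) (q (j - 1)) (s (j - 1)) (t (j - 1)) (\<rho> j)"
      "nth_deriv 1 \<eta> (\<rho> j) = biharm' (p (j - 1)) (q (j - 1)) (t (j - 1)) (\<rho> j)"
      "nth_deriv 2 \<eta> (\<rho> j) = biharm'' (p (j - 1)) (q (j - 1)) (t (j - 1)) (\<rho> j)"
      by (rule bd; assumption)+
  qed
  have right: "\<eta> (\<rho> j) = biharm (p j) (q j) (s j) (t j) (\<rho> j)"
    "nth_deriv 1 \<eta> (\<rho> j) = biharm' (p j) (q j) (t j) (\<rho> j)"
    "nth_deriv 2 \<eta> (\<rho> j) = biharm'' (p j) (q j) (t j) (\<rho> j)"
    if j: "j \<in> {1..n}" for j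
  proof -
    have le: "j \<le> n" using j by auto
    note bd = Ck_at_boundary[OF knot_pos[OF j] C2[OF j] open_piece piece_pos[OF le]
        knot_limit_point(2)[OF j] on_piece[OF le]]
    show "\<eta> (\<rho> j) = biharm (p j) (q j) (s j) (t j) (\<rho> j)"
      "nth_deriv 1 \<eta> (\<rho> j) = biharm' (p j) (q j) (t j) (\<rho> j)"
      "nth_deriv 2 \<eta> (\<rho> j) = biharm'' (p j) (q j) (t j) (\<rho> j)"
      by (rule bd; assumption)+
  qed
  have jump: "p j = p (j - 1) - a j * of_real ((1 + ln (\<rho> j)) / (\<rho> j)\<^sup>2)"
    "q j = q (j - 1) + a j * of_real (1 / (\<rho> j)\<^sup>2)"
    "s j = s (j - 1) + a j * of_real (1 - ln (\<rho> j))"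
    if j: "j \<in> {1..n}" for j
    unfolding a_def
    by (fact biharm_contact[OF knot_pos[OF j] left(1)[OF j, unfolded right(1)[OF j], symmetric]
        left(2)[OF j, unfolded right(2)[OF j], symmetric] left(3)[OF j, unfolded right(3)[OF j], symmetric]])+
  have tk: "t k = ln_coeff a k" and sk: "s k = const_coeff (s 0) a k" if "k \<le> n" for k
  proof -
    from that have "t k = ln_coeff a k \<and> s k = const_coeff (s 0) a k"
    proof (induction k)
      case 0
      then show ?case by (simp add: ends)
    next
      case (Suc k)
      then have k: "Suc k \<in> {1..n}" by auto
      have "t (Suc k) = t k + a (Suc k)" by (simp add: a_def)
      with coeff_step(3)[OF k, of "s 0" a] coeff_step(4)[OF k, of a] jump(3)[OF k] Suc show ?case
        by simp
    qed
    then show "t k = ln_coeff a k" "s k = const_coeff (s 0) a k" by auto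
  qed
  have pk: "p k = sq_coeff a k" and qk: "q k = sq_ln_coeff a k" if "k \<le> n" for k
  proof -
    from that have "p k = sq_coeff a k \<and> q k = sq_ln_coeff a k"
    proof (induction k rule: inc_induct)
      case base
      then show ?case by (simp add: ends)
    next
      case (step k)
      then have "Suc k \<in> {1..n}" by auto
      from coeff_step(1,2)[OF this, of a] jump(1,2)[OF this] step.IH show ?case by simp
    qed
    then show "p k = sq_coeff a k" "q k = sq_ln_coeff a k" by auto
  qed
  have "s 0 = \<eta> 0"
  proof -
    have "(\<eta> \<longlongrightarrow> \<eta> 0) (at 0 within {0..})"
      using \<eta> by (simp add: beppo_levi_splines_def continuous_within)
    then have "(\<eta> \<longlongrightarrow> \<eta> 0) (at_right 0)"
      by (rule tendsto_within_subset) auto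
    moreover have "\<forall>\<^sub>F r in at_right 0. biharm (p 0) (q 0) (s 0) 0 r = \<eta> r"
      using eventually_at_right_real[OF first_pos]
      by eventually_elim (use on_piece[of 0] ends in \<open>simp add: piece_def\<close>)
    then have "(\<eta> \<longlongrightarrow> s 0) (at_right 0)"
      using biharm_tendsto_0 by (rule tendsto_cong[THEN iffD1])
    ultimately show ?thesis
      using tendsto_unique[OF trivial_limit_at_right_real] by blast
  qed
  have "has_phi0_expansion n \<rho> \<eta> (\<eta> 0) a"
    unfolding has_phi0_expansion_def
  proof (intro allI impI)
    fix r :: real assume "0 \<le> r"
    show "\<eta> r = \<eta> 0 + (\<Sum>k=1..n. a k * of_real (phi0 (r / \<rho> k)))"
    proof (cases "r = 0")
      case True
      then show ?thesis by (simp add: phi0_def)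
    next
      case False
      then have "0 < r" using \<open>0 \<le> r\<close> by simp
      then obtain k where k: "k \<le> n" "r \<in> piece k \<or> 1 \<le> k \<and> r = \<rho> k"
        "\<forall>i\<in>{1..k}. \<rho> i \<le> r" "\<forall>i\<in>{k<..n}. r \<le> \<rho> i"
        using piece_cases by blast
      have "\<eta> r = biharm (p k) (q k) (s k) (t k) r"
        using k(1,2) on_piece right(1)[of k] by auto
      also have "\<dots> = \<eta> 0 + (\<Sum>k=1..n. a k * of_real (phi0 (r / \<rho> k)))"
        using expansion_on_piece[OF k(1) \<open>0 < r\<close> bspec[OF k(3)] bspec[OF k(4)], of "\<eta> 0" a] k(1)
        by (simp add: pk qk sk tk \<open>s 0 = \<eta> 0\<close>)
      finally show ?thesis .
    qed
  qed
  moreover have "(\<Sum>k=1..n. a k * of_real (1 / (\<rho> k)\<^sup>2)) = 0" if "nonsingular \<rho> \<eta>"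
  proof -
    from that obtain A B where AB: "\<And>r. r \<in> piece 0 \<Longrightarrow> \<eta> r = biharm A 0 B 0 r"
      unfolding nonsingular_def piece_def biharm_def by (auto simp: mult.commute)
    have f: "\<eta> r = biharm (p 0) (q 0) (s 0) 0 r" if "r \<in> piece 0" for r
      using on_piece[of 0] that ends by simp
    (* Both formulas describe the spline near any x < \<rho> 1; contact there forces q 0 = 0. *)
    define x where "x = \<rho> 1 / 2"
    have x: "x \<in> piece 0" "0 < x" using first_pos by (auto simp: piece_def x_def)
    note d = nth_deriv_biharm[OF open_piece piece_pos[of 0] AB x(1), simplified]
      nth_deriv_biharm[OF open_piece piece_pos[of 0] f x(1), simplified]
    have "q 0 = 0 + (0 - 0) * of_real (1 / x\<^sup>2)"
      by (rule biharm_contact(2)[OF x(2), of A 0 B 0 "p 0" _ "s 0" 0])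
         (use AB[OF x(1)] f[OF x(1)] d in auto)
    moreover have "{0<..n} = {1..n}" by auto
    ultimately show ?thesis using qk[of 0] by (simp add: sq_ln_coeff_def)
  qed
  ultimately show ?thesis using that by blast
qed

end

section \<open>Reality and uniqueness of the coefficients\<close>

theorem theorem4:
  fixes n :: nat and \<rho> \<nu> :: "nat \<Rightarrow> real" and \<alpha> :: real and \<sigma> :: "real \<Rightarrow> complex"
  assumes "n \<ge> 1"
    and "0 < \<rho> 1"
    and "strict_mono_on {1..n} \<rho>"
    and "is_sigma_A n \<rho> \<alpha> \<nu> \<sigma> \<or> is_sigma_B n \<rho> \<nu> \<sigma>"
  shows "\<exists>(c :: real) (a :: nat \<Rightarrow> real).
           has_phi0_expansion n \<rho> \<sigma> (of_real c) (\<lambda>k. of_real (a k)) \<and>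
           (is_sigma_B n \<rho> \<nu> \<sigma> \<longrightarrow> (\<Sum>k=1..n. a k * \<rho> k powi (-2)) = 0) \<and>
           (\<forall>(d :: complex) (b :: nat \<Rightarrow> complex). has_phi0_expansion n \<rho> \<sigma> d b \<longrightarrow>
              d = of_real c \<and> (\<forall>k\<in>{1..n}. b k = of_real (a k)))"
proof -
  interpret knots n \<rho> by unfold_locales (use assms in auto)
  have spline: "\<sigma> \<in> beppo_levi_splines n \<rho>" and vals: "\<And>j. j \<in> {1..n} \<Longrightarrow> \<sigma> (\<rho> j) = of_real (\<nu> j)"
    using assms(4) by (auto simp: is_sigma_A_def is_sigma_B_def)
  obtain a where expn: "has_phi0_expansion n \<rho> \<sigma> (\<sigma> 0) a"
    and sing: "nonsingular \<rho> \<sigma> \<longrightarrow> (\<Sum>k=1..n. a k * of_real (1 / (\<rho> k)\<^sup>2)) = 0"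
    by (rule spline_expansion[OF spline])
  have at_knot: "of_real (\<nu> j) = d + (\<Sum>k=1..n. b k * of_real (phi0 (\<rho> j / \<rho> k)))"
    if "has_phi0_expansion n \<rho> \<sigma> d b" "j \<in> {1..n}" for d b j
    using that vals[OF that(2)] knot_pos[OF that(2)] by (simp add: has_phi0_expansion_def)
  have Im_zero: "Im (\<sigma> 0) + (\<Sum>k=1..n. Im (a k) * phi0 (\<rho> j / \<rho> k)) = 0" if "j \<in> {1..n}" for j
    using arg_cong[OF at_knot[OF expn that], of Im] by simp
  have "Im (\<sigma> 0) = 0 \<or> (\<Sum>k=1..n. Im (a k) / (\<rho> k)\<^sup>2) = 0"
    using assms(4)
  proof
    assume "is_sigma_A n \<rho> \<alpha> \<nu> \<sigma>"
    then show ?thesis by (simp add: is_sigma_A_def)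
  next
    assume "is_sigma_B n \<rho> \<nu> \<sigma>"
    then have "Im (\<Sum>k=1..n. a k * of_real (1 / (\<rho> k)\<^sup>2)) = 0"
      using sing by (simp add: is_sigma_B_def)
    then have "(\<Sum>k=1..n. Im (a k) * (1 / (\<rho> k)\<^sup>2)) = 0"
      unfolding Im_sum Im_complex_of_real[symmetric] by (simp only: times_complex.sel Im_complex_of_real Re_complex_of_real mult_zero_right add_0)
    then show ?thesis by simp
  qed
  note real = vanishing_expansion[OF Im_zero this]
  have \<sigma>0: "\<sigma> 0 = of_real (Re (\<sigma> 0))" and a: "\<And>k. k \<in> {1..n} \<Longrightarrow> a k = of_real (Re (a k))"
    using real by (simp_all add: complex_eq_iff)
  have "has_phi0_expansion n \<rho> \<sigma> (of_real (Re (\<sigma> 0))) (\<lambda>k. of_real (Re (a k)))"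
  proof -
    have "(\<Sum>k=1..n. a k * of_real (phi0 (r / \<rho> k))) = (\<Sum>k=1..n. of_real (Re (a k)) * of_real (phi0 (r / \<rho> k)))" for r
      by (intro sum.cong refl) (use a in metis)
    then show ?thesis using expn \<sigma>0 unfolding has_phi0_expansion_def by metis
  qed
  moreover have "(\<Sum>k=1..n. Re (a k) * \<rho> k powi (-2)) = 0" if "is_sigma_B n \<rho> \<nu> \<sigma>"
  proof -
    have "Re (\<Sum>k=1..n. a k * of_real (1 / (\<rho> k)\<^sup>2)) = 0"
      using sing that by (simp add: is_sigma_B_def)
    then have "(\<Sum>k=1..n. Re (a k) * (1 / (\<rho> k)\<^sup>2)) = 0"
      unfolding Re_sum by (simp only: times_complex.sel Im_complex_of_real Re_complex_of_real mult_zero_right diff_0_right)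
    then show ?thesis by (simp add: power_int_minus power_int_numeral inverse_eq_divide)
  qed
  moreover have "d = of_real (Re (\<sigma> 0)) \<and> (\<forall>k\<in>{1..n}. b k = of_real (Re (a k)))"
    if b: "has_phi0_expansion n \<rho> \<sigma> d b" for d b
  proof -
    have "\<sigma> 0 = d" using b by (simp add: has_phi0_expansion_def phi0_def)
    have diff: "(\<Sum>k=1..n. (b k - a k) * of_real (phi0 (\<rho> j / \<rho> k))) = 0" if "j \<in> {1..n}" for j
      using at_knot[OF b that] at_knot[OF expn that] \<open>\<sigma> 0 = d\<close>
      by (simp add: left_diff_distrib sum_subtractf)
    have Re0: "0 + (\<Sum>k=1..n. Re (b k - a k) * phi0 (\<rho> j / \<rho> k)) = 0" if "j \<in> {1..n}" for j
      using arg_cong[OF diff[OF that], of Re] by simp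
    have Im0: "0 + (\<Sum>k=1..n. Im (b k - a k) * phi0 (\<rho> j / \<rho> k)) = 0" if "j \<in> {1..n}" for j
      using arg_cong[OF diff[OF that], of Im] by simp
    have "b k = a k" if "k \<in> {1..n}" for k
      using vanishing_expansion(2)[OF Re0 _ that] vanishing_expansion(2)[OF Im0 _ that]
      by (simp add: complex_eq_iff)
    then show ?thesis using \<open>\<sigma> 0 = d\<close> \<sigma>0 a by metis
  qed
  ultimately show ?thesis
    by (intro exI[of _ "Re (\<sigma> 0)"] exI[of _ "\<lambda>k. Re (a k)"]) blast
qed

end
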